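(* Every production-distribution game is a linear production game. That is, for every production-distribution game $(N,v)$ there exists a linear production game $(N,v')$ on the same player set $N$ such that $v'(S)=v(S)$ for all $S\subseteq N$.
   Context: Production-distribution game: let $N=\{1,\dots,n\}$ (players) and $M=\{1,\dots,m\}$ (markets) with $n,m\ge 1$. The data are per-unit profits $\alpha_{ij}\ge 0$, demands $d_{ij}\ge 0$ ($i\in N$, $j\in M$) and capacities $q_i\ge 0$ ($i\in N$). The associated game $(N,v)$ has, for $S\subseteq N$, $$v(S)=\max\Big\{\sum_{i\in S}\sum_{j\in M}\alpha_{ij}y_{ij}\;:\;\sum_{i\in S}y_{ij}\le\sum_{i\in S}d_{ij}\ \forall j\in M,\ \sum_{j\in M}y_{ij}\le q_i\ \forall i\in S,\ y_{ij}\ge 0\ \forall i\in S,j\in M\Big\}.$$ Linear production game: the data are a player set $N=\{1,\dots,n\}$, a number $r$ of resources and $p$ of products, for each player $i\in N$ a resource vector $b^i\in\mathbb{R}^r$ with $b^i\ge 0$, a price vector $c\in\mathbb{R}^p$, and a production matrix $A=[a_{kj}]\in\mathbb{R}^{r\times p}$, where $a_{kj}$ is the amount of resource $k$ needed to produce one unit of product $j$ ($A$ and $c$ do not depend on the coalition). The associated game $(N,v')$ has, for $S\subseteq N$, $$v'(S)=\max\Big\{cx\;:\;Ax\le\sum_{i\in S}b^i,\ x\ge 0\Big\}.$$ *)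

theory Defs
  imports "HOL-Analysis.Analysis"
begin

text \<open>
  Vectors and matrices are functions on \<^typ>\<open>nat\<close>; only their entries at indices counted from
  1 up to the stated dimension matter. The player set is \<^term>\<open>{1..n::nat}\<close>.
\<close>

definition has_maximum :: "real set \<Rightarrow> bool" where
  "has_maximum V \<longleftrightarrow> (\<exists>w\<in>V. \<forall>u\<in>V. u \<le> w)"

text \<open>Unspecified unless \<^term>\<open>has_maximum V\<close>.\<close>

definition maximum :: "real set \<Rightarrow> real" where
  "maximum V = (GREATEST w. w \<in> V)"

lemma maximum_eqI:
  assumes "w \<in> V" "\<And>u. u \<in> V \<Longrightarrow> u \<le> w"
  shows "maximum V = w"
  unfolding maximum_def using assms by (rule Greatest_equality)


subsection \<open>Production-distribution games\<close>

definition pd_data ::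
  "nat \<Rightarrow> nat \<Rightarrow> (nat \<Rightarrow> nat \<Rightarrow> real) \<Rightarrow> (nat \<Rightarrow> nat \<Rightarrow> real) \<Rightarrow> (nat \<Rightarrow> real) \<Rightarrow> bool" where
  "pd_data n m \<alpha> d q \<longleftrightarrow>
     1 \<le> n \<and> 1 \<le> m \<and>
     (\<forall>i\<in>{1..n}. \<forall>j\<in>{1..m}. 0 \<le> \<alpha> i j) \<and>
     (\<forall>i\<in>{1..n}. \<forall>j\<in>{1..m}. 0 \<le> d i j) \<and>
     (\<forall>i\<in>{1..n}. 0 \<le> q i)"

definition pd_feasible ::
  "nat \<Rightarrow> (nat \<Rightarrow> nat \<Rightarrow> real) \<Rightarrow> (nat \<Rightarrow> real) \<Rightarrow> nat set \<Rightarrow> (nat \<Rightarrow> nat \<Rightarrow> real) \<Rightarrow> bool" where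
  "pd_feasible m d q S y \<longleftrightarrow>
     (\<forall>j\<in>{1..m}. (\<Sum>i\<in>S. y i j) \<le> (\<Sum>i\<in>S. d i j)) \<and>
     (\<forall>i\<in>S. (\<Sum>j\<in>{1..m}. y i j) \<le> q i) \<and>
     (\<forall>i\<in>S. \<forall>j\<in>{1..m}. 0 \<le> y i j)"

definition pd_values ::
  "nat \<Rightarrow> (nat \<Rightarrow> nat \<Rightarrow> real) \<Rightarrow> (nat \<Rightarrow> nat \<Rightarrow> real) \<Rightarrow> (nat \<Rightarrow> real) \<Rightarrow> nat set \<Rightarrow> real set" where
  "pd_values m \<alpha> d q S = {\<Sum>i\<in>S. \<Sum>j\<in>{1..m}. \<alpha> i j * y i j | y. pd_feasible m d q S y}"

definition pd_game ::
  "nat \<Rightarrow> (nat \<Rightarrow> nat \<Rightarrow> real) \<Rightarrow> (nat \<Rightarrow> nat \<Rightarrow> real) \<Rightarrow> (nat \<Rightarrow> real) \<Rightarrow> nat set \<Rightarrow> real" where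
  "pd_game m \<alpha> d q S = maximum (pd_values m \<alpha> d q S)"

text \<open>The maximum defining \<^const>\<open>pd_game\<close> is always attained.\<close>

lemma pd_values_has_maximum:
  assumes data: "pd_data n m \<alpha> d q" and S: "S \<subseteq> {1..n}"
  shows "has_maximum (pd_values m \<alpha> d q S)"
proof -
  define X where "X = (\<lambda>p. if p \<in> S \<times> {1..m} then {0..q (fst p)} else {0::real})"
  define K where "K = PiE UNIV X \<inter> {z. pd_feasible m d q S (curry z)}"
  define f where "f = (\<lambda>z. \<Sum>i\<in>S. \<Sum>j\<in>{1..m}. \<alpha> i j * z (i, j))"
  have coord: "continuous_on A (\<lambda>z. z p)" for A :: "(nat \<times> nat \<Rightarrow> real) set" and p
    by (rule continuous_on_subset[OF continuous_on_product_coordinates]) auto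
  have "compactin (product_topology (\<lambda>_. euclidean) UNIV) (PiE UNIV X)"
    by (auto simp: compactin_PiE X_def)
  then have "compact (PiE UNIV X)"
    by (simp add: euclidean_product_topology)
  moreover have "closed {z :: nat \<times> nat \<Rightarrow> real. pd_feasible m d q S (curry z)}"
    unfolding pd_feasible_def curry_def Ball_def
    by (intro closed_Collect_conj closed_Collect_all closed_Collect_imp closed_Collect_le
          open_Collect_const continuous_on_sum continuous_on_const coord)
  ultimately have "compact K"
    unfolding K_def by (rule compact_Int_closed)
  moreover have "(\<lambda>_. 0) \<in> K"
  proof -
    have "0 \<le> (\<Sum>i\<in>S. d i j)" if "j \<in> {1..m}" for j
      using data S that by (intro sum_nonneg) (auto simp: pd_data_def)
    then show ?thesis
      using data S unfolding K_def X_def pd_feasible_def pd_data_def by (auto simp: subset_iff)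
  qed
  moreover have "continuous_on K f"
    unfolding f_def by (intro continuous_intros coord)
  ultimately obtain z where z: "z \<in> K" "\<And>x. x \<in> K \<Longrightarrow> f x \<le> f z"
    using continuous_attains_sup[of K f] by blast
  have "f z \<in> pd_values m \<alpha> d q S"
    using z(1) unfolding pd_values_def f_def K_def by (auto simp: curry_def)
  moreover have "u \<le> f z" if u: "u \<in> pd_values m \<alpha> d q S" for u
  proof -
    obtain y where y: "pd_feasible m d q S y" "u = (\<Sum>i\<in>S. \<Sum>j\<in>{1..m}. \<alpha> i j * y i j)"
      using u unfolding pd_values_def by blast
    define x where "x = (\<lambda>p. if p \<in> S \<times> {1..m} then y (fst p) (snd p) else 0)"
    have "y i j \<le> q i" if ij: "i \<in> S" "j \<in> {1..m}" for i j
    proof -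
      have "y i j \<le> (\<Sum>j\<in>{1..m}. y i j)"
        using y(1) ij by (intro member_le_sum) (auto simp: pd_feasible_def)
      also have "\<dots> \<le> q i"
        using y(1) ij by (auto simp: pd_feasible_def)
      finally show ?thesis .
    qed
    then have "x \<in> PiE UNIV X"
      using y(1) by (auto simp: X_def x_def pd_feasible_def)
    moreover have "pd_feasible m d q S (curry x)"
    proof -
      have "curry x i j = y i j" if "i \<in> S" "j \<in> {1..m}" for i j
        using that by (simp add: x_def)
      moreover from this have "(\<Sum>j\<in>{1..m}. curry x i j) = (\<Sum>j\<in>{1..m}. y i j)" if "i \<in> S" for i
        using that by (intro sum.cong refl)
      ultimately show ?thesis
        using y(1) unfolding pd_feasible_def by (simp del: curry_conv cong: sum.cong)
    qed
    ultimately have "f x \<le> f z"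
      using z(2) by (simp add: K_def)
    moreover have "f x = u"
      unfolding f_def y(2) x_def by (intro sum.cong refl) auto
    ultimately show ?thesis by simp
  qed
  ultimately show ?thesis
    unfolding has_maximum_def by blast
qed


subsection \<open>Linear production games\<close>

definition lp_feasible ::
  "nat \<Rightarrow> nat \<Rightarrow> (nat \<Rightarrow> nat \<Rightarrow> real) \<Rightarrow> (nat \<Rightarrow> nat \<Rightarrow> real) \<Rightarrow> nat set \<Rightarrow> (nat \<Rightarrow> real) \<Rightarrow> bool" where
  "lp_feasible r p b A S x \<longleftrightarrow>
     (\<forall>k\<in>{1..r}. (\<Sum>j\<in>{1..p}. A k j * x j) \<le> (\<Sum>i\<in>S. b i k)) \<and>
     (\<forall>j\<in>{1..p}. 0 \<le> x j)"

definition lp_values ::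
  "nat \<Rightarrow> nat \<Rightarrow> (nat \<Rightarrow> nat \<Rightarrow> real) \<Rightarrow> (nat \<Rightarrow> real) \<Rightarrow> (nat \<Rightarrow> nat \<Rightarrow> real) \<Rightarrow> nat set \<Rightarrow> real set" where
  "lp_values r p b c A S = {\<Sum>j\<in>{1..p}. c j * x j | x. lp_feasible r p b A S x}"

definition lp_game ::
  "nat \<Rightarrow> nat \<Rightarrow> (nat \<Rightarrow> nat \<Rightarrow> real) \<Rightarrow> (nat \<Rightarrow> real) \<Rightarrow> (nat \<Rightarrow> nat \<Rightarrow> real) \<Rightarrow> nat set \<Rightarrow> real" where
  "lp_game r p b c A S = maximum (lp_values r p b c A S)"

text \<open>
  Neither \<open>A\<close> nor \<open>c\<close> is sign-constrained, so the linear program of a coalition may be unbounded;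
  the data define a game only if every coalition's maximum is attained.
\<close>

definition lp_data ::
  "nat \<Rightarrow> nat \<Rightarrow> nat \<Rightarrow> (nat \<Rightarrow> nat \<Rightarrow> real) \<Rightarrow> (nat \<Rightarrow> real) \<Rightarrow> (nat \<Rightarrow> nat \<Rightarrow> real) \<Rightarrow> bool" where
  "lp_data n r p b c A \<longleftrightarrow>
     (\<forall>i\<in>{1..n}. \<forall>k\<in>{1..r}. 0 \<le> b i k) \<and>
     (\<forall>S\<subseteq>{1..n}. has_maximum (lp_values r p b c A S))"

end

theory Submission
  imports Defs
begin

text \<open>
  Take one product for each pair of a player and a market, and one resource for each market and each
  player. Producing a unit of product \<open>(i, j)\<close> uses one unit of market resource \<open>j\<close> and one unit of
  player resource \<open>i\<close>; player \<open>i\<close> owns \<open>d i j\<close> of market resource \<open>j\<close>, \<open>q i\<close> of player resource \<open>i\<close>,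
  and none of the other player resources. A coalition \<open>S\<close> then owns nothing of the player resources
  outside \<open>S\<close>, which forces the production of their products to be \<open>0\<close>: although the matrix does not
  depend on \<open>S\<close>, the linear programs of the two games have the same attainable values.
\<close>

text \<open>
  Resources \<open>1, \<dots>, m\<close> are the markets and \<open>m + 1, \<dots>, m + n\<close> the players; \<open>e\<close> enumerates the products.
\<close>

definition pd_resources ::
  "nat \<Rightarrow> (nat \<Rightarrow> nat \<Rightarrow> real) \<Rightarrow> (nat \<Rightarrow> real) \<Rightarrow> nat \<Rightarrow> nat \<Rightarrow> real" where
  "pd_resources m d q i k = (if k \<le> m then d i k else if k = m + i then q i else 0)"

definition pd_matrix :: "nat \<Rightarrow> (nat \<Rightarrow> nat \<times> nat) \<Rightarrow> nat \<Rightarrow> nat \<Rightarrow> real" where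
  "pd_matrix m e k l = (if k \<le> m then of_bool (snd (e l) = k) else of_bool (m + fst (e l) = k))"

lemma sum_enumerated_pairs:
  assumes "bij_betw e {1..p} (I \<times> J)"
  shows "(\<Sum>l\<in>{1..p::nat}. g (e l)) = (\<Sum>i\<in>I. \<Sum>j\<in>J. g (i, j))"
  using sum.reindex_bij_betw[OF assms, of g] by (simp add: sum.cartesian_product)

lemma ball_atLeastAtMost_add:
  "(\<forall>k\<in>{1..m + n::nat}. P k) \<longleftrightarrow> (\<forall>j\<in>{1..m}. P j) \<and> (\<forall>i\<in>{1..n}. P (m + i))"
proof -
  have "{1..m + n} = {1..m} \<union> (+) m ` {1..n}"
    by auto
  then show ?thesis
    by (simp only: ball_Un ball_simps)
qed

text \<open>Row \<open>j\<close> of the matrix adds up a market's supply over all players, and row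
  \<open>m + i\<close> adds up a player's output over all markets. Since \<open>z\<close> is any
  plan on pairs that agrees with \<open>x\<close> along \<open>e\<close>, the lemma serves both to
  decode a given \<open>x\<close> and to encode a given plan.\<close>

lemma lp_feasible_pd:
  assumes e: "bij_betw e {1..p} ({1..n} \<times> {1..m})" and S: "S \<subseteq> {1..n}"
    and x: "\<forall>l\<in>{1..p}. x l = z (e l)"
  shows "lp_feasible (m + n) p (pd_resources m d q) (pd_matrix m e) S x \<longleftrightarrow>
    (\<forall>j\<in>{1..m}. (\<Sum>i\<in>{1..n}. z (i, j)) \<le> (\<Sum>i\<in>S. d i j)) \<and>
    (\<forall>i\<in>{1..n}. (\<Sum>j\<in>{1..m}. z (i, j)) \<le> (if i \<in> S then q i else 0)) \<and>
    (\<forall>i\<in>{1..n}. \<forall>j\<in>{1..m}. 0 \<le> z (i, j))"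
proof -
  have fin: "finite S"
    using S by (rule finite_subset) simp
  have market: "(\<Sum>l\<in>{1..p}. pd_matrix m e j l * x l) = (\<Sum>i\<in>{1..n}. z (i, j))"
    if "j \<in> {1..m}" for j
  proof -
    have "(\<Sum>l\<in>{1..p}. pd_matrix m e j l * x l) = (\<Sum>l\<in>{1..p}. of_bool (snd (e l) = j) * z (e l))"
      using that x by (intro sum.cong) (auto simp: pd_matrix_def)
    also have "\<dots> = (\<Sum>i\<in>{1..n}. \<Sum>j'\<in>{1..m}. of_bool (j' = j) * z (i, j'))"
      using sum_enumerated_pairs[OF e, of "\<lambda>w. of_bool (snd w = j) * z w"] by simp
    finally show ?thesis
      using that by (simp add: of_bool_def if_distrib[of "\<lambda>a. a * _"] sum.delta cong: if_cong)
  qed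
  have player: "(\<Sum>l\<in>{1..p}. pd_matrix m e (m + i) l * x l) = (\<Sum>j\<in>{1..m}. z (i, j))"
    if "i \<in> {1..n}" for i
  proof -
    have "(\<Sum>l\<in>{1..p}. pd_matrix m e (m + i) l * x l)
        = (\<Sum>l\<in>{1..p}. of_bool (fst (e l) = i) * z (e l))"
      using that x by (intro sum.cong) (auto simp: pd_matrix_def)
    also have "\<dots> = (\<Sum>i'\<in>{1..n}. \<Sum>j\<in>{1..m}. of_bool (i' = i) * z (i', j))"
      using sum_enumerated_pairs[OF e, of "\<lambda>w. of_bool (fst w = i) * z w"] by simp
    \<comment> \<open>With the sum over players innermost, the indicator selects the single term
      \<open>i' = i\<close>.\<close>
    also have "\<dots> = (\<Sum>j\<in>{1..m}. \<Sum>i'\<in>{1..n}. of_bool (i' = i) * z (i', j))"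
      by (rule sum.swap)
    finally show ?thesis
      using that by (simp add: of_bool_def if_distrib[of "\<lambda>a. a * _"] sum.delta cong: if_cong)
  qed
  have demand: "(\<Sum>i\<in>S. pd_resources m d q i j) = (\<Sum>i\<in>S. d i j)" if "j \<in> {1..m}" for j
    using that by (simp add: pd_resources_def)
  \<comment> \<open>As \<open>i\<close> is at least 1, index \<open>m + i\<close> is past the
    markets, and only player \<open>i\<close> owns that resource.\<close>
  have capacity: "(\<Sum>i'\<in>S. pd_resources m d q i' (m + i)) = (if i \<in> S then q i else 0)"
    if "i \<in> {1..n}" for i
    using that fin by (simp add: pd_resources_def sum.delta')
  have "(\<forall>l\<in>{1..p}. 0 \<le> x l) \<longleftrightarrow> (\<forall>w\<in>e ` {1..p}. 0 \<le> z w)"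
    using x by simp
  also have "\<dots> \<longleftrightarrow> (\<forall>i\<in>{1..n}. \<forall>j\<in>{1..m}. 0 \<le> z (i, j))"
    unfolding bij_betw_imp_surj_on[OF e] by blast
  finally show ?thesis
    unfolding lp_feasible_def ball_atLeastAtMost_add
    by (simp only: market player demand capacity conj_assoc cong: ball_cong)
qed

text \<open>Equality of the whole value sets, not just of their maxima, also transfers the existence
  of a maximum, which \<open>lp_data\<close> demands.\<close>

lemma lp_values_pd:
  assumes e: "bij_betw e {1..p} ({1..n} \<times> {1..m})" and S: "S \<subseteq> {1..n}"
  shows "lp_values (m + n) p (pd_resources m d q) (\<lambda>l. case_prod \<alpha> (e l)) (pd_matrix m e) S
    = pd_values m \<alpha> d q S" (is "?L = ?R")
proof
  have objective: "(\<Sum>l\<in>{1..p}. case_prod \<alpha> (e l) * x l) = (\<Sum>i\<in>S. \<Sum>j\<in>{1..m}. \<alpha> i j * z (i, j))"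
    if "\<forall>l\<in>{1..p}. x l = z (e l)"
      and "\<And>i j. i \<in> {1..n} - S \<Longrightarrow> j \<in> {1..m} \<Longrightarrow> z (i, j) = 0" for x z
  proof -
    have "(\<Sum>l\<in>{1..p}. case_prod \<alpha> (e l) * x l) = (\<Sum>i\<in>{1..n}. \<Sum>j\<in>{1..m}. \<alpha> i j * z (i, j))"
      using sum_enumerated_pairs[OF e, of "\<lambda>w. case_prod \<alpha> w * z w"] that(1) by simp
    also have "\<dots> = (\<Sum>i\<in>S. \<Sum>j\<in>{1..m}. \<alpha> i j * z (i, j))"
      using S that(2) by (intro sum.mono_neutral_right) auto
    finally show ?thesis .
  qed
  have restrict: "(\<Sum>i\<in>{1..n}. z (i, j)) = (\<Sum>i\<in>S. z (i, j))"
    if "\<And>i. i \<in> {1..n} - S \<Longrightarrow> z (i, j) = 0" for z :: "nat \<times> nat \<Rightarrow> real" and j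
    using S that by (intro sum.mono_neutral_right) auto
  show "?L \<subseteq> ?R"
  proof
    fix u assume "u \<in> ?L"
    then obtain x where u: "u = (\<Sum>l\<in>{1..p}. case_prod \<alpha> (e l) * x l)"
      and feas: "lp_feasible (m + n) p (pd_resources m d q) (pd_matrix m e) S x"
      unfolding lp_values_def by blast
    define z where "z = x \<circ> inv_into {1..p} e"
    have xz: "\<forall>l\<in>{1..p}. x l = z (e l)"
      using e by (simp add: z_def bij_betw_inv_into_left)
    note constraints = feas[unfolded lp_feasible_pd[OF e S xz]]
    \<comment> \<open>A single nonnegative entry is bounded by its row sum, and that sum is at most
      the capacity 0 of a player outside \<open>S\<close>.\<close>
    have zero: "z (i, j) = 0" if "i \<in> {1..n} - S" "j \<in> {1..m}" for i j
    proof -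
      have "z (i, j) \<le> (\<Sum>j\<in>{1..m}. z (i, j))"
        using constraints that by (intro member_le_sum) auto
      also have "\<dots> \<le> 0"
        using constraints that by (metis DiffE)
      finally show ?thesis
        using constraints that by (intro antisym) auto
    qed
    have "pd_feasible m d q S (curry z)"
      unfolding pd_feasible_def
    proof (intro conjI ballI)
      fix j assume j: "j \<in> {1..m}"
      then have "(\<Sum>i\<in>S. curry z i j) = (\<Sum>i\<in>{1..n}. z (i, j))"
        using restrict[of z j] zero by simp
      also have "\<dots> \<le> (\<Sum>i\<in>S. d i j)"
        using constraints j by blast
      finally show "(\<Sum>i\<in>S. curry z i j) \<le> (\<Sum>i\<in>S. d i j)" .
    next
      fix i assume "i \<in> S"
      then have "(\<Sum>j\<in>{1..m}. z (i, j)) \<le> (if i \<in> S then q i else 0)"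
        using constraints S by blast
      then show "(\<Sum>j\<in>{1..m}. curry z i j) \<le> q i"
        using \<open>i \<in> S\<close> by simp
    next
      fix i j assume "i \<in> S" "j \<in> {1..m}"
      then show "0 \<le> curry z i j"
        using constraints S by auto
    qed
    moreover have "u = (\<Sum>i\<in>S. \<Sum>j\<in>{1..m}. \<alpha> i j * curry z i j)"
      using u objective[OF xz zero] by simp
    ultimately show "u \<in> ?R"
      unfolding pd_values_def by blast
  qed
  show "?R \<subseteq> ?L"
  proof
    fix u assume "u \<in> ?R"
    then obtain y where u: "u = (\<Sum>i\<in>S. \<Sum>j\<in>{1..m}. \<alpha> i j * y i j)" and feas: "pd_feasible m d q S y"
      unfolding pd_values_def by blast
    \<comment> \<open>\<open>pd_feasible\<close> says nothing about \<open>y\<close> outside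
      \<open>S\<close>, so these entries are reset to 0 before the sums are extended to all
      players.\<close>
    define z where "z = (\<lambda>(i, j). if i \<in> S then y i j else 0)"
    have "(\<Sum>i\<in>{1..n}. z (i, j)) = (\<Sum>i\<in>S. y i j)" for j
      using restrict[of z j] by (simp add: z_def)
    then have "lp_feasible (m + n) p (pd_resources m d q) (pd_matrix m e) S (z \<circ> e)"
      using feas S by (subst lp_feasible_pd[OF e S, of _ z]) (auto simp: pd_feasible_def z_def)
    moreover have "u = (\<Sum>l\<in>{1..p}. case_prod \<alpha> (e l) * (z \<circ> e) l)"
      using u by (subst objective[of _ z]) (auto simp: z_def)
    ultimately show "u \<in> ?L"
      unfolding lp_values_def by blast
  qed
qed

theorem lemma1:
  fixes n m :: nat and \<alpha> d :: "nat \<Rightarrow> nat \<Rightarrow> real" and q :: "nat \<Rightarrow> real"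
  assumes "pd_data n m \<alpha> d q"
  shows "\<exists>(r::nat) (p::nat) (b :: nat \<Rightarrow> nat \<Rightarrow> real) (c :: nat \<Rightarrow> real) (A :: nat \<Rightarrow> nat \<Rightarrow> real).
           lp_data n r p b c A \<and>
           (\<forall>S\<subseteq>{1..n}. lp_game r p b c A S = pd_game m \<alpha> d q S)"
proof -
  obtain e :: "nat \<Rightarrow> nat \<times> nat" where e: "bij_betw e {1..n * m} ({1..n} \<times> {1..m})"
    using finite_same_card_bij[of "{1..n * m}" "{1..n} \<times> {1..m}"] by auto
  let ?b = "pd_resources m d q" and ?c = "\<lambda>l. case_prod \<alpha> (e l)" and ?A = "pd_matrix m e"
  \<comment> \<open>Resources are nonnegative because demands and capacities are; boundedness is
    inherited from the production-distribution game.\<close>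
  have "lp_data n (m + n) (n * m) ?b ?c ?A"
    using assms pd_values_has_maximum[OF assms] unfolding lp_data_def
    by (auto simp: lp_values_pd[OF e] pd_resources_def pd_data_def)
  moreover have "\<forall>S\<subseteq>{1..n}. lp_game (m + n) (n * m) ?b ?c ?A S = pd_game m \<alpha> d q S"
    by (simp add: lp_game_def pd_game_def lp_values_pd[OF e])
  ultimately show ?thesis
    by blast
qed

end
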